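(* Let $m$ and $k$ be positive integers, and suppose there exists a positive integer that is a $k$th power non-residue modulo $m$; let $n=n_k(m)$ be the least such positive integer. Let $R=R_k(m)$ be the greatest number of consecutive integers $a+1,a+2,\ldots,a+R$ ($a\in\mathbb Z$) that are all $k$th power residues modulo $m$. Then $R<m/n$. Consequently, if $m$ is a prime, then $n<\sqrt m+1/2$. Moreover: let $p$ be an odd prime and $k$ a positive integer with $\gcd(k,p-1)>1$. If $-1$ is a $k$th power residue modulo $p$ (equivalently, $(p-1)/\gcd(k,p-1)$ is even) and $n_k(p)\neq 2$, where $n_k(p)$ is the least positive $k$th power non-residue modulo $p$, then $n_k(p)<\sqrt{p/2}+1/4$.
   Context: For a positive integer $m$ and an integer $a$ with $\gcd(a,m)=1$: $a$ is called a $k$th power residue modulo $m$ if the congruence $x^k\equiv a \pmod m$ has an integer solution $x$, and a $k$th power non-residue modulo $m$ otherwise. Integers not coprime to $m$ are neither $k$th power residues nor $k$th power non-residues. *)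

theory Defs
  imports Complex_Main "HOL-Number_Theory.Number_Theory"
begin

definition power_residue :: "nat \<Rightarrow> nat \<Rightarrow> int \<Rightarrow> bool" where
  "power_residue k m a \<longleftrightarrow> coprime a (int m) \<and> (\<exists>x::int. [x ^ k = a] (mod int m))"

definition power_nonresidue :: "nat \<Rightarrow> nat \<Rightarrow> int \<Rightarrow> bool" where
  "power_nonresidue k m a \<longleftrightarrow> coprime a (int m) \<and> \<not> (\<exists>x::int. [x ^ k = a] (mod int m))"

definition least_nonresidue :: "nat \<Rightarrow> nat \<Rightarrow> nat" where
  "least_nonresidue k m = (LEAST n. 0 < n \<and> power_nonresidue k m (int n))"

definition residue_run :: "nat \<Rightarrow> nat \<Rightarrow> nat \<Rightarrow> bool" where
  "residue_run k m r \<longleftrightarrow> (\<exists>a::int. \<forall>i\<in>{1..r}. power_residue k m (a + int i))"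

definition max_residue_run :: "nat \<Rightarrow> nat \<Rightarrow> nat" where
  "max_residue_run k m = (GREATEST r. residue_run k m r)"

text \<open>
  The operators \<open>LEAST\<close> and \<open>GREATEST\<close> are unspecified when no least or greatest element
  exists. The following facts show that this does not happen when a positive non-residue exists,
  and that one exists modulo an odd prime \<open>p\<close> whenever \<open>gcd k (p - 1) > 1\<close>.
\<close>

lemma least_nonresidue_props:
  assumes "\<exists>n>0. power_nonresidue k m (int n)"
  shows "0 < least_nonresidue k m" "power_nonresidue k m (int (least_nonresidue k m))"
    and "\<And>n. 0 < n \<Longrightarrow> power_nonresidue k m (int n) \<Longrightarrow> least_nonresidue k m \<le> n"
  unfolding least_nonresidue_def
  using LeastI_ex[of "\<lambda>n. 0 < n \<and> power_nonresidue k m (int n)"] assms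
  by (auto intro: Least_le)

lemma residue_run_less:
  assumes "m > 0" "power_nonresidue k m b" "residue_run k m r"
  shows "r < m"
proof (rule ccontr)
  assume "\<not> r < m"
  hence le: "m \<le> r" by simp
  obtain a where a: "\<forall>i\<in>{1..r}. power_residue k m (a + int i)"
    using assms(3) unfolding residue_run_def by blast
  define j where "j = (b - a - 1) mod int m"
  have j: "0 \<le> j" "j < int m" using assms(1) by (auto simp: j_def)
  hence "nat j + 1 \<in> {1..r}" using le by auto
  hence "power_residue k m (a + int (nat j + 1))" using a by blast
  moreover have "int (nat j + 1) = j + 1" using j by simp
  ultimately have res: "power_residue k m (a + (j + 1))" by (simp only:)
  have "[j = b - a - 1] (mod int m)" by (simp add: j_def cong_def)
  from cong_add[OF this cong_refl[of "a + 1"]] have "[a + (j + 1) = b] (mod int m)"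
    by (simp add: algebra_simps)
  with res assms(2) show False
    unfolding power_residue_def power_nonresidue_def by (meson cong_trans)
qed

lemma max_residue_run_props:
  assumes "m > 0" "\<exists>n>0. power_nonresidue k m (int n)"
  shows "residue_run k m (max_residue_run k m)"
    and "\<And>r. residue_run k m r \<Longrightarrow> r \<le> max_residue_run k m"
proof -
  have bound: "r \<le> m" if "residue_run k m r" for r
    using residue_run_less that assms by (metis less_imp_le)
  have "residue_run k m 0" by (simp add: residue_run_def)
  thus "residue_run k m (max_residue_run k m)"
    unfolding max_residue_run_def by (rule GreatestI_nat) (use bound in blast)
  show "r \<le> max_residue_run k m" if "residue_run k m r" for r
    unfolding max_residue_run_def using that by (rule Greatest_le_nat) (use bound in blast)
qed

lemma ex_power_nonresidue:
  assumes p: "prime p" and gcd: "gcd k (p - 1) > 1"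
  shows "\<exists>n>0. power_nonresidue k p (int n)"
proof -
  obtain g where g: "residue_primroot p g"
    using prime_primitive_root_exists[of p] p prime_gt_1_nat[of p] by auto
  have ord: "ord p g = p - 1" "coprime p g"
    using g p by (auto simp: residue_primroot_def totient_prime)
  define d where "d = gcd k (p - 1)"
  have d: "d dvd k" "d dvd p - 1" "d > 1" using gcd by (auto simp: d_def)
  have p1: "p - 1 > 0" using prime_gt_1_nat[OF p] by simp
  have g0: "g > 0" using ord(2) p by (metis coprime_0_right_iff gr0I not_prime_unit)
  have "\<not> (\<exists>x::int. [x ^ k = int g] (mod int p))"
  proof
    assume "\<exists>x::int. [x ^ k = int g] (mod int p)"
    then obtain x :: int where x: "[x ^ k = int g] (mod int p)" by blast
    define y where "y = nat (x mod int p)"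
    have y: "int y = x mod int p" using p1 by (simp add: y_def)
    have "[int y ^ k = x ^ k] (mod int p)" by (rule cong_pow) (simp add: y cong_def)
    with x have "[int (y ^ k) = int g] (mod int p)" by (simp add: cong_trans)
    hence yg: "[y ^ k = g] (mod p)" using cong_int_iff by blast
    obtain e where e: "p - 1 = d * e" using d(2) by blast
    obtain f where f: "k = d * f" using d(1) by blast
    have "coprime p (y ^ k)" using yg ord(2) by (metis cong_imp_coprime cong_sym coprime_commute)
    hence cop: "k = 0 \<or> coprime p y" by auto
    have "[y ^ (k * e) = 1] (mod p)"
    proof (cases "k = 0")
      case False
      hence "[y ^ (p - 1) = 1] (mod p)"
        using cop euler_theorem[of y p] p by (auto simp: totient_prime coprime_commute)
      hence "[(y ^ (p - 1)) ^ f = 1] (mod p)" using cong_pow[of "y ^ (p - 1)" 1 p f] by simp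
      moreover have "(y ^ (p - 1)) ^ f = y ^ (k * e)"
        unfolding e f power_mult [symmetric] by (simp only: ac_simps)
      ultimately show ?thesis by (simp only:)
    qed auto
    moreover have "[y ^ (k * e) = g ^ e] (mod p)"
      using cong_pow[OF yg, of e] by (simp add: power_mult)
    ultimately have "[g ^ e = 1] (mod p)" by (meson cong_sym cong_trans)
    hence "d * e dvd e" using ord e ord_divides by metis
    moreover have "e > 0" using e p1 by (cases e) auto
    ultimately show False using d(3) by (auto dest: dvd_imp_le)
  qed
  thus ?thesis unfolding power_nonresidue_def
    using g0 ord(2) by (auto simp: coprime_commute intro!: exI[of _ g])
qed

end

theory Submission
  imports Defs
begin

text \<open>
  Multiplication by a residue preserves non-residues. So if \<open>a+1, \<dots>, a+R\<close> are residues modulo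
  \<open>m\<close>, then \<open>n(a+1), \<dots>, n(a+R)\<close> are non-residues. If \<open>n R \<ge> m\<close>, this progression of step \<open>n\<close>
  meets \<open>[q m, q m + n)\<close> for some \<open>q\<close>, which yields a non-residue congruent to some \<open>r < n\<close>,
  against the minimality of \<open>n\<close>. For prime \<open>m\<close> the numbers \<open>1, \<dots>, n-1\<close> form a run, so
  \<open>n(n-1) < m\<close>.

  If \<open>-1\<close> and \<open>2\<close> are residues modulo \<open>p\<close>, then so are all even numbers up to \<open>2n-2\<close>. Hence \<open>p\<close>
  is at distance at least \<open>n\<close> from every \<open>n t\<close> with \<open>t \<le> 2n-2\<close> even and positive, which forces
  \<open>p > n(2n-1)\<close>.
\<close>

section \<open>Products of residues and non-residues\<close>

lemma power_nonresidue_cong: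
  assumes "[a = b] (mod int m)"
  shows "power_nonresidue k m a \<longleftrightarrow> power_nonresidue k m b"
  using assms unfolding power_nonresidue_def
  by (meson cong_imp_coprime cong_sym cong_trans)

lemma power_residue_1: "power_residue k m 1"
  unfolding power_residue_def by (auto intro!: exI[of _ 1])

lemma power_residue_mult:
  assumes "power_residue k m a" "power_residue k m b"
  shows "power_residue k m (a * b)"
proof -
  obtain x y where "[x ^ k = a] (mod int m)" "[y ^ k = b] (mod int m)"
    using assms unfolding power_residue_def by blast
  hence "[(x * y) ^ k = a * b] (mod int m)"
    by (simp add: power_mult_distrib cong_mult)
  thus ?thesis using assms unfolding power_residue_def by auto
qed

text \<open>A \<open>k\<close>th root \<open>x\<close> of \<open>a\<close> is invertible modulo
  \<open>m\<close>, so a \<open>k\<close>th root of \<open>a * b\<close>, multiplied by the inverse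
  \<open>z\<close> of \<open>x\<close>, would be a \<open>k\<close>th root of
  \<open>b\<close>.\<close>

lemma power_nonresidue_mult:
  assumes "k > 0" "power_residue k m a" "power_nonresidue k m b"
  shows "power_nonresidue k m (a * b)"
proof -
  obtain x where x: "[x ^ k = a] (mod int m)" and a: "coprime a (int m)"
    using assms(2) unfolding power_residue_def by blast
  have "coprime (x ^ k) (int m)" using x a cong_imp_coprime cong_sym by blast
  \<comment> \<open>For \<open>k = 0\<close> the power would carry no information about
    \<open>x\<close>.\<close>
  hence "coprime x (int m)" using assms(1) by simp
  then obtain z where z: "[x * z = 1] (mod int m)"
    using cong_solve_coprime_int by blast
  have "\<not> [y ^ k = a * b] (mod int m)" for y
  proof
    assume "[y ^ k = a * b] (mod int m)"
    also have "[a * b = x ^ k * b] (mod int m)"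
      using x by (intro cong_mult cong_refl) (rule cong_sym)
    finally have "[y ^ k * z ^ k = x ^ k * b * z ^ k] (mod int m)"
      by (intro cong_mult cong_refl)
    hence "[(y * z) ^ k = (x * z) ^ k * b] (mod int m)"
      by (simp add: power_mult_distrib mult_ac)
    also have "[(x * z) ^ k * b = 1 ^ k * b] (mod int m)"
      using z by (intro cong_mult cong_pow cong_refl)
    finally have "[(y * z) ^ k = b] (mod int m)" by simp
    thus False using assms(3) unfolding power_nonresidue_def by blast
  qed
  thus ?thesis using a assms(3) unfolding power_nonresidue_def by auto
qed

lemma least_nonresidue_le_int:
  assumes "power_nonresidue k m r" "0 < r"
  shows "int (least_nonresidue k m) \<le> r"
proof -
  have "power_nonresidue k m (int (nat r))" "0 < nat r" using assms by auto
  hence "least_nonresidue k m \<le> nat r" using least_nonresidue_props(3) by blast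
  thus ?thesis using assms(2) by simp
qed

text \<open>Modulo 1 everything is a residue. This serves to rule out 0 as a non-residue, since 0 is
  coprime to \<open>m\<close> only for \<open>m = 1\<close>.\<close>

lemma power_nonresidue_gt_1:
  assumes "power_nonresidue k m b" "m > 0"
  shows "m > 1"
proof (rule ccontr)
  assume "\<not> m > 1"
  hence "m = 1" using assms(2) by simp
  thus False using assms(1) by (auto simp: power_nonresidue_def)
qed

section \<open>Runs of residues\<close>

lemma residue_run_times_least_nonresidue:
  assumes m: "m > 0" and k: "k > 0" and ex: "\<exists>n>0. power_nonresidue k m (int n)"
    and run: "residue_run k m r"
  shows "r * least_nonresidue k m < m"
proof (rule ccontr)
  define n where "n = least_nonresidue k m"
  assume "\<not> r * least_nonresidue k m < m"
  hence le: "int m \<le> int r * int n" by (simp add: n_def flip: of_nat_mult)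
  have n: "n > 0" "power_nonresidue k m (int n)"
    using least_nonresidue_props(1,2)[OF ex] by (auto simp: n_def)
  have m1: "m > 1" using power_nonresidue_gt_1 n(2) m by blast
  obtain a where a: "\<And>i. i \<in> {1..r} \<Longrightarrow> power_residue k m (a + int i)"
    using run unfolding residue_run_def by blast
  \<comment> \<open>\<open>q * m\<close> is the first multiple of \<open>m\<close> strictly above
    \<open>a * n\<close>.\<close>
  define q where "q = a * int n div int m + 1"
  have q: "a * int n < q * int m" "q * int m \<le> a * int n + int m"
    using div_mult_mod_eq[of "a * int n" "int m"] pos_mod_bound[of "int m" "a * int n"]
      pos_mod_sign[of "int m" "a * int n"] m
    unfolding q_def distrib_right by linarith+
  \<comment> \<open>Negating around the floor division rounds up: \<open>t\<close> is the ceiling of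
    \<open>q * m / n\<close>, and \<open>s\<close> is the overshoot
    \<open>t * n - q * m\<close>.\<close>
  define s where "s = (- (q * int m)) mod int n"
  define t where "t = - ((- (q * int m)) div int n)"
  have st: "t * int n = q * int m + s"
    using div_mult_mod_eq[of "- (q * int m)" "int n"]
    unfolding s_def t_def mult_minus_left by linarith
  have s: "0 \<le> s" "s < int n" using n by (auto simp: s_def)
  have "a * int n < t * int n" using st s q by linarith
  hence ta: "a < t" using n(1) by simp
  \<comment> \<open>Here \<open>m \<le> r * n\<close> enters:
    \<open>t * n < q * m + n \<le> a * n + m + n\<close>, so \<open>t\<close> does not leave the
    run.\<close>
  have "t * int n < (a + int r + 1) * int n"
    using st s q le unfolding distrib_right by linarith
  hence tr: "t < a + int r + 1" using n(1) by (simp add: mult_less_cancel_right)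
  have "power_residue k m (a + int (nat (t - a)))" using ta tr by (intro a) auto
  hence res: "power_residue k m t" using ta by simp
  have "power_nonresidue k m (t * int n)" by (rule power_nonresidue_mult[OF k res n(2)])
  moreover have "[t * int n = s] (mod int m)" by (simp add: st cong_def)
  ultimately have non: "power_nonresidue k m s" using power_nonresidue_cong by blast
  hence "s \<noteq> 0" using m1 by (auto simp: power_nonresidue_def)
  thus False using least_nonresidue_le_int[OF non] s by (simp add: n_def)
qed

section \<open>The least non-residue and a prime modulus\<close>

lemma least_nonresidue_less:
  assumes m: "m > 0" and ex: "\<exists>n>0. power_nonresidue k m (int n)"
  shows "least_nonresidue k m < m"
proof -
  define r where "r = int (least_nonresidue k m) mod int m"
  have "power_nonresidue k m r"
    using least_nonresidue_props(2)[OF ex] power_nonresidue_cong[of "int (least_nonresidue k m)" r m k]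
    by (simp add: r_def cong_def)
  moreover from this have "r \<noteq> 0" using power_nonresidue_gt_1 m
    by (fastforce simp: power_nonresidue_def)
  hence "0 < r" using m by (simp add: r_def order_le_neq_trans)
  ultimately have "int (least_nonresidue k m) \<le> r" by (rule least_nonresidue_le_int)
  also have "r < int m" using m by (simp add: r_def)
  finally show ?thesis by simp
qed

text \<open>Minimality only says that \<open>i\<close> is not a non-residue; primality of
  \<open>p\<close> and \<open>i < p\<close> supply the coprimality that makes it a residue.\<close>

lemma power_residue_less_least:
  assumes p: "prime p" and ex: "\<exists>n>0. power_nonresidue k p (int n)"
    and i: "0 < i" "i < int (least_nonresidue k p)"
  shows "power_residue k p i"
proof -
  have "i < int p" using i(2) least_nonresidue_less[OF prime_gt_0_nat[OF p] ex] by simp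
  hence "\<not> int p dvd i" using i(1) zdvd_not_zless by blast
  hence "coprime i (int p)"
    using p prime_imp_coprime[of "int p" i] by (simp add: coprime_commute)
  moreover have "\<not> power_nonresidue k p i" using least_nonresidue_le_int i by fastforce
  ultimately show ?thesis by (auto simp: power_residue_def power_nonresidue_def)
qed

lemma least_nonresidue_prime_bound:
  assumes p: "prime p" and k: "k > 0" and ex: "\<exists>n>0. power_nonresidue k p (int n)"
  shows "real (least_nonresidue k p) < sqrt (real p) + 1 / 2"
proof -
  define n where "n = least_nonresidue k p"
  have n: "n > 0" using least_nonresidue_props(1)[OF ex] by (simp add: n_def)
  have run: "residue_run k p (n - 1)" unfolding residue_run_def
    by (rule exI[of _ 0]) (auto simp: n_def intro!: power_residue_less_least[OF p ex])
  \<comment> \<open>The gain of 1 from integrality exceeds the 1/4 in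
    \<open>(n - 1/2)^2 = n * (n - 1) + 1/4\<close>.\<close>
  have "(n - 1) * n + 1 \<le> p"
    using residue_run_times_least_nonresidue[OF prime_gt_0_nat[OF p] k ex run] by (simp add: n_def)
  hence "real ((n - 1) * n + 1) \<le> real p" by (simp only: of_nat_le_iff)
  hence "(real n - 1 / 2)\<^sup>2 < real p"
    using n by (simp add: of_nat_diff power2_eq_square algebra_simps)
  hence "real n - 1 / 2 < sqrt (real p)" by (rule real_less_rsqrt)
  thus ?thesis by (simp add: n_def)
qed

section \<open>When -1 is a residue\<close>

text \<open>Let \<open>d = gcd k (p - 1)\<close> and \<open>e = (p - 1) / d\<close>. If
  \<open>x ^ k\<close> is -1, raising to the power \<open>e\<close> gives 1 by Fermat, so
  \<open>e\<close> is even. Conversely, a primitive root to the power \<open>(p - 1) / 2\<close> is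
  -1, and for even \<open>e\<close> this exponent is a multiple of \<open>d\<close>, hence of
  \<open>k\<close> modulo \<open>p - 1\<close>.\<close>

lemma minus_one_power_residue_iff:
  assumes p: "prime p" "odd p" and k: "k > 0"
  shows "power_residue k p (- 1) \<longleftrightarrow> even ((p - 1) div gcd k (p - 1))"
proof
  define d where "d = gcd k (p - 1)"
  define e where "e = (p - 1) div d"
  have p2: "p > 2" using p prime_ge_2_nat[of p] by (cases "p = 2") auto
  have e: "p - 1 = d * e" by (simp add: d_def e_def)
  have cong1: "\<not> [1 = - 1] (mod int p)"
    using p2 zdvd_not_zless[of 2 "int p"] by (auto simp: cong_iff_dvd_diff)
  {
    assume "power_residue k p (- 1)"
    then obtain x where x: "[x ^ k = - 1] (mod int p)"
      unfolding power_residue_def by blast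
    have "coprime (x ^ k) (int p)" using cong_imp_coprime[OF cong_sym[OF x]] by simp
    hence "\<not> int p dvd x" using k p2
      by (auto simp: coprime_commute dest: coprime_common_divisor)
    define y where "y = nat (x mod int p)"
    have y: "[int y = x] (mod int p)" using p2 by (simp add: y_def cong_def)
    have "\<not> p dvd y" using \<open>\<not> int p dvd x\<close> y
      by (metis cong_dvd_iff int_dvd_int_iff)
    hence "[y ^ (p - 1) = 1] (mod p)" using fermat_theorem p(1) by blast
    hence "[int (y ^ (p - 1)) = int 1] (mod int p)" by (simp only: cong_int_iff)
    hence "[int y ^ (p - 1) = 1] (mod int p)" by simp
    moreover have "[int y ^ (p - 1) = x ^ (p - 1)] (mod int p)" by (rule cong_pow[OF y])
    ultimately have x1: "[x ^ (p - 1) = 1] (mod int p)" by (meson cong_sym cong_trans)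
    obtain f where f: "k = d * f" unfolding d_def by (meson dvdE gcd_dvd1)
    have "[(x ^ k) ^ e = (- 1) ^ e] (mod int p)" by (rule cong_pow[OF x])
    moreover have "(x ^ k) ^ e = (x ^ (p - 1)) ^ f"
      unfolding e f power_mult [symmetric] by (simp only: ac_simps)
    moreover have "[(x ^ (p - 1)) ^ f = 1 ^ f] (mod int p)" by (rule cong_pow[OF x1])
    ultimately have "[1 = (- 1) ^ e] (mod int p)" by (metis cong_sym cong_trans power_one)
    hence "even e" using cong1 by (cases "even e") auto
    thus "even ((p - 1) div gcd k (p - 1))" by (simp add: e_def d_def)
  next
    assume "even ((p - 1) div gcd k (p - 1))"
    then obtain c where c: "e = 2 * c" unfolding e_def d_def by blast
    obtain g where g: "residue_primroot p g"
      using prime_primitive_root_exists[of p] p2 p(1) by auto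
    have ord: "ord p g = p - 1" using g p by (auto simp: residue_primroot_def totient_prime)
    have dc: "2 * (d * c) = p - 1" using e c by simp
    \<comment> \<open>Since \<open>d * c = (p - 1) / 2\<close>, \<open>h\<close> is a square root of
      1 other than 1, hence -1.\<close>
    define h where "h = int g ^ (d * c)"
    have g1: "[g ^ (p - 1) = 1] (mod p)" using ord ord_divides by (metis dvd_refl)
    have "\<not> [g ^ (d * c) = 1] (mod p)"
    proof
      assume "[g ^ (d * c) = 1] (mod p)"
      hence "p - 1 dvd d * c" using ord ord_divides by metis
      moreover have "d * c > 0" using dc p2 by (cases "d * c") auto
      ultimately have "p - 1 \<le> d * c" by (rule dvd_imp_le)
      thus False using dc \<open>d * c > 0\<close> by linarith
    qed
    hence h1: "\<not> [h = 1] (mod int p)"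
      unfolding h_def using cong_int_iff[of "g ^ (d * c)" 1 p] by simp
    have g1': "[int g ^ (p - 1) = 1] (mod int p)"
      using g1 cong_int_iff[of "g ^ (p - 1)" 1 p] by simp
    have "h * h = int g ^ (p - 1)" unfolding h_def dc[symmetric]
      by (simp add: mult_2 flip: power_add)
    hence "[h * h = 1] (mod int p)" using g1' by simp
    hence "int p dvd (h - 1) * (h + 1)" by (simp add: cong_iff_dvd_diff algebra_simps)
    hence "int p dvd h + 1"
      using h1 p(1) by (auto simp: cong_iff_dvd_diff prime_dvd_mult_iff)
    hence h: "[h = - 1] (mod int p)" by (simp add: cong_iff_dvd_diff)
    \<comment> \<open>Multiplied by \<open>c\<close>, this Bezout relation shows that
      \<open>g ^ (u * c)\<close> is a \<open>k\<close>th root of \<open>h\<close>.\<close>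
    obtain u v where uv: "k * u = (p - 1) * v + d"
      using bezout_nat[of k "p - 1"] k unfolding d_def by auto
    have "k * u * c = (p - 1) * (v * c) + d * c" unfolding uv by (simp add: algebra_simps)
    hence "(int g ^ (u * c)) ^ k = (int g ^ (p - 1)) ^ (v * c) * h"
      unfolding h_def power_mult [symmetric] power_add [symmetric] by (simp add: ac_simps)
    also have "[\<dots> = 1 ^ (v * c) * (- 1)] (mod int p)"
      by (intro cong_mult cong_pow g1' h)
    finally show "power_residue k p (- 1)" unfolding power_residue_def by auto
  }
qed

section \<open>The sharper bound when -1 is a residue\<close>

lemma least_nonresidue_minus_one_residue:
  assumes p: "prime p" "odd p" and k: "k > 0"
    and ex: "\<exists>n>0. power_nonresidue k p (int n)"
    and neg: "power_residue k p (- 1)" and n2: "least_nonresidue k p \<noteq> 2"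
  shows "least_nonresidue k p * (2 * least_nonresidue k p - 1) < p"
proof (rule ccontr)
  define n where "n = least_nonresidue k p"
  assume "\<not> ?thesis"
  hence le: "p \<le> n * (2 * n - 1)" by (simp add: n_def)
  have n: "n > 0" "power_nonresidue k p (int n)"
    using least_nonresidue_props(1,2)[OF ex] by (auto simp: n_def)
  have "n \<noteq> 1" using n(2) power_residue_1[of k p]
    by (auto simp: power_nonresidue_def power_residue_def)
  hence n3: "n > 2" using n(1) n2 by (simp add: n_def)
  have np: "n < p" using least_nonresidue_less[OF prime_gt_0_nat[OF p(1)] ex] by (simp add: n_def)
  have res: "power_residue k p i" if "0 < i" "i < int n" for i
    using power_residue_less_least[OF p(1) ex] that by (simp add: n_def)
  \<comment> \<open>A difference \<open>s\<close> of absolute value below \<open>n\<close> would be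
    a residue up to sign, hence a residue, yet congruent to the non-residue
    \<open>2 * c * n\<close>. Oddness of \<open>p\<close> excludes \<open>s = 0\<close>.\<close>
  have far: "\<not> (0 < c \<and> c < n \<and> \<bar>int p - int n * (2 * int c)\<bar> < int n)" for c
  proof
    assume c: "0 < c \<and> c < n \<and> \<bar>int p - int n * (2 * int c)\<bar> < int n"
    define s where "s = int n * (2 * int c) - int p"
    have "power_residue k p 2" "power_residue k p (int c)" using c n3 by (auto intro: res)
    hence "power_residue k p (2 * int c)" by (rule power_residue_mult)
    hence "power_nonresidue k p (2 * int c * int n)" using n(2) by (rule power_nonresidue_mult[OF k])
    moreover have "[2 * int c * int n = s] (mod int p)"
      by (simp add: s_def cong_iff_dvd_diff mult_ac)
    ultimately have non: "power_nonresidue k p s" using power_nonresidue_cong by blast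
    have "s \<noteq> 0"
    proof
      assume "s = 0"
      hence "int p = 2 * (int n * int c)" by (simp add: s_def)
      hence "even (int p)" by (rule dvdI)
      thus False using p(2) by simp
    qed
    have "power_residue k p s"
    proof (cases "s > 0")
      case True
      thus ?thesis using c by (intro res) (auto simp: s_def)
    next
      case False
      have "power_residue k p (- s)" using c False \<open>s \<noteq> 0\<close> by (intro res) (auto simp: s_def)
      from power_residue_mult[OF neg this] show ?thesis by simp
    qed
    thus False using non by (auto simp: power_residue_def power_nonresidue_def)
  qed
  define t where "t = p div n"
  define s where "s = p mod n"
  have st: "int p = int n * int t + int s"
    by (simp add: s_def t_def flip: of_nat_mult of_nat_add)
  \<comment> \<open>This excludes the odd multiples of \<open>n\<close>, which lie at distance
    exactly \<open>n\<close> from the neighbouring even ones and so escape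
    \<open>far\<close>.\<close>
  have "\<not> n dvd p" using p(1) np n3 by (auto simp: prime_nat_iff)
  hence s: "0 < s" "s < n" using n by (auto simp: s_def mod_greater_zero_iff_not_dvd)
  have "t > 0" using np n by (simp add: t_def div_greater_zero_iff)
  have "n * t < n * (2 * n - 1)"
    using s le mult_div_mod_eq[of n p] unfolding s_def t_def by linarith
  hence t: "t < 2 * n - 1" by simp
  show False
  \<comment> \<open>An even multiple of \<open>n\<close> near \<open>p\<close> is
    \<open>n * t\<close> at distance \<open>s\<close>, or \<open>n * (t + 1)\<close> at distance
    \<open>n - s\<close>. For odd \<open>t\<close>, the bound \<open>t < 2 * n - 1\<close> keeps
    \<open>c + 1 < n\<close>.\<close>
  proof (cases "even t")
    case True
    then obtain c where c: "t = 2 * c" by blast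
    show False using far[of c] st s t \<open>t > 0\<close> unfolding c by auto
  next
    case False
    then obtain c where c: "t = 2 * c + 1" by (rule oddE)
    have "int p - int n * (2 * int (c + 1)) = int s - int n"
      using st unfolding c by (simp add: algebra_simps)
    thus False using far[of "c + 1"] s t c by auto
  qed
qed

lemma least_nonresidue_minus_one_residue_bound:
  assumes "prime p" "odd p" "k > 0" and ex: "\<exists>n>0. power_nonresidue k p (int n)"
    and "power_residue k p (- 1)" "least_nonresidue k p \<noteq> 2"
  shows "real (least_nonresidue k p) < sqrt (real p / 2) + 1 / 4"
proof -
  define n where "n = least_nonresidue k p"
  have n: "n > 0" using least_nonresidue_props(1)[OF ex] by (simp add: n_def)
  have "n * (2 * n - 1) + 1 \<le> p"
    using least_nonresidue_minus_one_residue[OF assms] by (simp add: n_def)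
  hence "real (n * (2 * n - 1) + 1) \<le> real p" by (simp only: of_nat_le_iff)
  \<comment> \<open>The square is \<open>n * (2 * n - 1) / 2 + 1/16\<close>, and integrality leaves
    room for 1/2.\<close>
  hence "(real n - 1 / 4)\<^sup>2 < real p / 2"
    using n by (simp add: of_nat_diff power2_eq_square algebra_simps)
  hence "real n - 1 / 4 < sqrt (real p / 2)" by (rule real_less_rsqrt)
  thus ?thesis by (simp add: n_def)
qed

theorem theorem1:
  "(\<forall>m k :: nat. m > 0 \<longrightarrow> k > 0 \<longrightarrow> (\<exists>n>0. power_nonresidue k m (int n)) \<longrightarrow>
      real (max_residue_run k m) < real m / real (least_nonresidue k m) \<and>
      (prime m \<longrightarrow> real (least_nonresidue k m) < sqrt (real m) + 1 / 2))
   \<and>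
   (\<forall>p k :: nat. prime p \<longrightarrow> odd p \<longrightarrow> k > 0 \<longrightarrow> gcd k (p - 1) > 1 \<longrightarrow>
      (power_residue k p (- 1) \<longleftrightarrow> even ((p - 1) div gcd k (p - 1))) \<and>
      (power_residue k p (- 1) \<longrightarrow> least_nonresidue k p \<noteq> 2 \<longrightarrow>
         real (least_nonresidue k p) < sqrt (real p / 2) + 1 / 4))"
proof (intro conjI allI impI)
  fix m k :: nat
  assume m: "m > 0" and k: "k > 0" and ex: "\<exists>n>0. power_nonresidue k m (int n)"
  have "max_residue_run k m * least_nonresidue k m < m"
    using residue_run_times_least_nonresidue[OF m k ex max_residue_run_props(1)[OF m ex]] .
  hence "real (max_residue_run k m) * real (least_nonresidue k m) < real m"
    by (simp flip: of_nat_mult)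
  thus "real (max_residue_run k m) < real m / real (least_nonresidue k m)"
    using least_nonresidue_props(1)[OF ex] by (simp add: pos_less_divide_eq)
  show "real (least_nonresidue k m) < sqrt (real m) + 1 / 2" if "prime m"
    using least_nonresidue_prime_bound[OF that k ex] .
next
  fix p k :: nat
  assume "prime p" "odd p" "k > 0" "gcd k (p - 1) > 1"
  thus "power_residue k p (- 1) \<longleftrightarrow> even ((p - 1) div gcd k (p - 1))"
    by (intro minus_one_power_residue_iff)
next
  fix p k :: nat
  assume "prime p" "odd p" "k > 0" "gcd k (p - 1) > 1"
    and "power_residue k p (- 1)" "least_nonresidue k p \<noteq> 2"
  thus "real (least_nonresidue k p) < sqrt (real p / 2) + 1 / 4"
    by (intro least_nonresidue_minus_one_residue_bound ex_power_nonresidue)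
qed

end
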